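(* For every integer $k\ge 1$ we have $\tau_k^{(\mathrm{lcm})}\le 1.7/\log p_k$, where $p_k$ is the $k$th prime. In addition, $\tau_2^{(\mathrm{lcm})}\le 1$, and so the Erd\H{o}s conjecture is true for lcm $2$-primitive sets: every lcm $2$-primitive set $A$ satisfies $$\sum_{n\in A}\frac{1}{n\log n}\ \le\ \sum_{p}\frac{1}{p\log p},$$ where the right-hand sum is over all primes $p$.
   Context: A set $A\subset\mathbb{Z}_{>1}$ of integers greater than $1$ is called lcm $k$-primitive if no member of $A$ divides the least common multiple of $j$ distinct other members of $A$, for any $1\le j\le k$. The critical exponent $\tau_k^{(\mathrm{lcm})}$ is the real number such that, for real $\lambda$, the inequality $$\sum_{\substack{n\in A\\ n\le x}} n^{-\lambda}\le \sum_{\substack{p\le x\\ p\text{ prime}}} p^{-\lambda}$$ holds for all lcm $k$-primitive sets $A$ and all $x>1$ if and only if $\lambda\ge\tau_k^{(\mathrm{lcm})}$. $\log$ is the natural logarithm. *)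

theory Defs
  imports "HOL-Analysis.Analysis" "HOL-Computational_Algebra.Primes" "HOL-Library.Infinite_Set"
begin

definition lcm_primitive :: "nat \<Rightarrow> nat set \<Rightarrow> bool" where
  "lcm_primitive k A \<longleftrightarrow> (\<forall>n\<in>A. n > 1) \<and>
     (\<forall>n\<in>A. \<forall>S. S \<subseteq> A - {n} \<and> finite S \<and> 1 \<le> card S \<and> card S \<le> k \<longrightarrow> \<not> n dvd Lcm S)"

definition prime_sum_bound :: "nat \<Rightarrow> real \<Rightarrow> bool" where
  "prime_sum_bound k \<sigma> \<longleftrightarrow> (\<forall>A. \<forall>x::real. lcm_primitive k A \<and> x > 1 \<longrightarrow>
     (\<Sum>n | n \<in> A \<and> real n \<le> x. real n powr (-\<sigma>)) \<le> (\<Sum>p | prime p \<and> real p \<le> x. real p powr (-\<sigma>)))"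

(* Existence and uniqueness of the described number are proved below for all k >= 1,
   see prime_sum_bound_iff; without a real satisfying the equivalence THE would be arbitrary. *)
definition lcm_critical_exponent :: "nat \<Rightarrow> real" where
  "lcm_critical_exponent k = (THE \<tau>. \<forall>\<sigma>. prime_sum_bound k \<sigma> \<longleftrightarrow> \<sigma> \<ge> \<tau>)"

(* enumerate counts from 0; here the first prime is kth_prime 1 = 2. *)
definition kth_prime :: "nat \<Rightarrow> nat" where
  "kth_prime k = enumerate {p. prime p} (k - 1)"

lemma weighted_sum_nonneg:
  fixes d w :: "nat \<Rightarrow> real"
  assumes D: "\<And>m. (\<Sum>i<m. d i) \<ge> 0" and w: "\<And>i. w (Suc i) \<le> w i" "\<And>i. w i \<ge> 0"
  shows "(\<Sum>i<N. w i * d i) \<ge> 0"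
proof -
  have "(\<Sum>i<N. w i * d i) \<ge> w N * (\<Sum>i<N. d i)"
  proof (induction N)
    case (Suc N)
    have "w (Suc N) * (\<Sum>i<Suc N. d i) \<le> w N * (\<Sum>i<Suc N. d i)"
      by (rule mult_right_mono[OF w(1) D])
    with Suc show ?case by (simp add: algebra_simps)
  qed simp
  moreover have "w N * (\<Sum>i<N. d i) \<ge> 0" using D w by simp
  ultimately show ?thesis by linarith
qed

lemma sum_le_as_lessThan:
  fixes B :: "nat set" and x :: real
  assumes "0 \<notin> B" "x \<ge> 0"
  shows "(\<Sum>n | n \<in> B \<and> real n \<le> x. f n) = (\<Sum>i<nat \<lfloor>x\<rfloor>. if Suc i \<in> B then f (Suc i) else (0::real))"
proof -
  have "(\<Sum>i<nat \<lfloor>x\<rfloor>. if Suc i \<in> B then f (Suc i) else 0) = (\<Sum>i\<in>{i\<in>{..<nat \<lfloor>x\<rfloor>}. Suc i \<in> B}. f (Suc i))"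
    by (rule sum.inter_filter[symmetric]) simp
  also have "\<dots> = (\<Sum>n | n \<in> B \<and> real n \<le> x. f n)"
  proof (rule sum.reindex_bij_witness[of _ "\<lambda>n. n - 1" Suc])
    fix n assume n: "n \<in> {n. n \<in> B \<and> real n \<le> x}"
    then have "n > 0" using assms by (metis (mono_tags, lifting) gr0I mem_Collect_eq)
    moreover have "n \<le> nat \<lfloor>x\<rfloor>" using n by (simp add: le_nat_floor)
    ultimately show "n - 1 \<in> {i\<in>{..<nat \<lfloor>x\<rfloor>}. Suc i \<in> B}" "Suc (n - 1) = n" using n by auto
  next
    fix i assume i: "i \<in> {i\<in>{..<nat \<lfloor>x\<rfloor>}. Suc i \<in> B}"
    then have "real (Suc i) \<le> real (nat \<lfloor>x\<rfloor>)" by (simp only: of_nat_le_iff) auto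
    also have "\<dots> \<le> x" using assms by (simp add: of_nat_floor)
    finally show "Suc i \<in> {n. n \<in> B \<and> real n \<le> x}" using i by simp
  qed auto
  finally show ?thesis ..
qed

lemma prime_sum_bound_mono:
  assumes "prime_sum_bound k \<sigma>" "\<sigma> \<le> \<mu>"
  shows "prime_sum_bound k \<mu>"
  unfolding prime_sum_bound_def
proof (intro allI impI, elim conjE)
  fix A and x :: real assume A: "lcm_primitive k A" and x: "x > 1"
  have A1: "n > 1" if "n \<in> A" for n using A that by (auto simp: lcm_primitive_def)
  then have A0: "0 \<notin> A" by force
  let ?P = "{p::nat. prime p}"
  have P0: "0 \<notin> ?P" by simp
  define g where "g \<nu> B i = (if Suc i \<in> B then real (Suc i) powr (-\<nu>) else 0)" for \<nu> B i
  define d where "d i = g \<sigma> ?P i - g \<sigma> A i" for i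
  define w where "w i = real (Suc i) powr (-(\<mu>-\<sigma>))" for i
  have wd: "w i * d i = g \<mu> ?P i - g \<mu> A i" for i
    by (simp add: w_def d_def g_def algebra_simps flip: powr_add)
  have D: "(\<Sum>i<m. d i) \<ge> 0" for m
  proof (cases "m \<le> 1")
    case True
    then have "m = 0 \<or> m = 1" by auto
    moreover have "Suc 0 \<notin> A" using A1 by force
    ultimately show ?thesis by (auto simp: d_def g_def)
  next
    case False
    then have "(\<Sum>n | n \<in> A \<and> real n \<le> real m. real n powr (-\<sigma>))
        \<le> (\<Sum>n | n \<in> ?P \<and> real n \<le> real m. real n powr (-\<sigma>))"
      using assms(1)[unfolded prime_sum_bound_def, rule_format, of A "real m"] A by simp
    then show ?thesis
      unfolding sum_le_as_lessThan[OF A0 of_nat_0_le_iff] sum_le_as_lessThan[OF P0 of_nat_0_le_iff]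
      by (simp add: d_def g_def sum_subtractf)
  qed
  have "(\<Sum>i<nat \<lfloor>x\<rfloor>. w i * d i) \<ge> 0"
  proof (rule weighted_sum_nonneg[OF D])
    show "w (Suc i) \<le> w i" for i unfolding w_def using assms(2) by (intro powr_mono2') auto
  qed (simp add: w_def)
  then have "(\<Sum>i<nat \<lfloor>x\<rfloor>. g \<mu> A i) \<le> (\<Sum>i<nat \<lfloor>x\<rfloor>. g \<mu> ?P i)"
    unfolding wd by (simp add: sum_subtractf)
  then have "(\<Sum>n | n \<in> A \<and> real n \<le> x. real n powr (-\<mu>))
        \<le> (\<Sum>n | n \<in> ?P \<and> real n \<le> x. real n powr (-\<mu>))"
    using x by (simp only: sum_le_as_lessThan[OF A0] sum_le_as_lessThan[OF P0] g_def)
  then show "(\<Sum>n | n \<in> A \<and> real n \<le> x. real n powr (-\<mu>))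
        \<le> (\<Sum>p | prime p \<and> real p \<le> x. real p powr (-\<mu>))" by simp
qed

lemma not_prime_sum_bound_minus_two: "\<not> prime_sum_bound k (-2)"
proof
  assume b: "prime_sum_bound k (-2)"
  have "lcm_primitive k {4}" by (auto simp: lcm_primitive_def)
  then have *: "(\<Sum>n | n \<in> {4} \<and> real n \<le> 4. real n powr 2) \<le> (\<Sum>p | prime p \<and> real p \<le> 4. real p powr 2)"
    using b[unfolded prime_sum_bound_def, rule_format, of "{4}" 4] by simp
  have 1: "{n. n \<in> {4} \<and> real n \<le> 4} = {4}" by auto
  have 2: "{p. prime p \<and> real p \<le> 4} = {2,3}"
  proof (intro set_eqI iffI)
    fix p :: nat assume "p \<in> {p. prime p \<and> real p \<le> 4}"
    then have "prime p" "p \<le> 4" by auto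
    moreover have "\<not> prime (4::nat)" by (simp add: prime_nat_iff) (intro exI[of _ 2], simp)
    ultimately have "p \<noteq> 4" "p \<ge> 2" "p \<le> 4" using prime_ge_2_nat by auto
    then show "p \<in> {2,3}" by auto
  next
    fix p :: nat assume "p \<in> {2,3}"
    moreover have "prime (3::nat)" by simp
    ultimately show "p \<in> {p. prime p \<and> real p \<le> 4}" by auto
  qed
  from * show False unfolding 1 2 by simp
qed

lemma sum_inverse_squares_le: "(\<Sum>m\<in>{2..Suc N}. 1 / (real m)^2) \<le> 1 - 1 / real (Suc N)"
proof (induction N)
  case (Suc N)
  have "1 / (real (Suc (Suc N)))^2 \<le> 1 / real (Suc N) - 1 / real (Suc (Suc N))"
    by (simp add: divide_simps power2_eq_square)
  with Suc show ?case by (simp del: of_nat_Suc)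
qed simp

lemma prime_sum_bound_two:
  assumes "k \<ge> 1"
  shows "prime_sum_bound k 2"
  unfolding prime_sum_bound_def
proof (intro allI impI, elim conjE)
  fix A and x :: real assume A: "lcm_primitive k A" and x: "x > 1"
  define N where "N = nat \<lfloor>x\<rfloor>"
  have le_N: "real n \<le> x \<longleftrightarrow> n \<le> N" for n
    using x unfolding N_def by linarith
  have A1: "n > 1" if "n \<in> A" for n using A that by (auto simp: lcm_primitive_def)
  have prim: "\<not> n dvd m" if "n \<in> A" "m \<in> A" "m \<noteq> n" for n m
  proof -
    have "{m} \<subseteq> A - {n} \<and> finite {m} \<and> 1 \<le> card {m} \<and> card {m} \<le> k" using that assms by auto
    then have "\<not> n dvd Lcm {m}" using A that(1) unfolding lcm_primitive_def by blast
    then show ?thesis by simp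
  qed
  define l where "l n = (SOME p::nat. prime p \<and> p dvd n)" for n
  have l: "prime (l n)" "l n dvd n" if "n \<in> A" for n
  proof -
    have "\<exists>p::nat. prime p \<and> p dvd n" using A1[OF that] by (metis less_irrefl prime_factor_nat)
    from someI_ex[OF this] show "prime (l n)" "l n dvd n" by (auto simp: l_def)
  qed
  let ?A = "{n. n \<in> A \<and> n \<le> N}" and ?P = "{p. prime p \<and> p \<le> N}"
  have sub: "l ` ?A \<subseteq> ?P"
  proof
    fix p assume "p \<in> l ` ?A"
    then obtain n where n: "n \<in> A" "n \<le> N" "p = l n" by auto
    have "l n \<le> n" using l(2)[OF n(1)] A1[OF n(1)] by (intro dvd_imp_le) auto
    then show "p \<in> ?P" using n l(1)[OF n(1)] by simp
  qed
  have part: "(\<Sum>n\<in>{n\<in>?A. l n = p}. real n powr (-2)) \<le> real p powr (-2)" if p: "p \<in> ?P" for p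
  proof (cases "p \<in> A")
    case True
    have "{n\<in>?A. l n = p} \<subseteq> {p}" using prim[OF True] l by blast
    then have "(\<Sum>n\<in>{n\<in>?A. l n = p}. real n powr (-2)) \<le> (\<Sum>n\<in>{p}. real n powr (-2))"
      by (intro sum_mono2) auto
    then show ?thesis by simp
  next
    case False
    have pp: "p > 0" using p prime_gt_0_nat by auto
    have "{n\<in>?A. l n = p} \<subseteq> (\<lambda>m. p * m) ` {2..Suc N}"
    proof
      fix n assume n: "n \<in> {n\<in>?A. l n = p}"
      then have "p dvd n" using l by auto
      then obtain m where m: "n = p * m" by (elim dvdE)
      have "m \<noteq> 0" using A1[of n] n m by (intro notI) auto
      moreover have "m \<noteq> 1" using False n m by auto
      moreover have "m \<le> n" using m pp by simp
      ultimately have "m \<in> {2..Suc N}" using n by auto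
      then show "n \<in> (\<lambda>m. p * m) ` {2..Suc N}" using m by blast
    qed
    then have "(\<Sum>n\<in>{n\<in>?A. l n = p}. real n powr (-2)) \<le> (\<Sum>n\<in>(\<lambda>m. p * m) ` {2..Suc N}. real n powr (-2))"
      by (intro sum_mono2) auto
    also have "\<dots> = (\<Sum>m\<in>{2..Suc N}. real (p * m) powr (-2))"
      by (subst sum.reindex) (use pp in \<open>auto simp: inj_on_def\<close>)
    also have "\<dots> = real p powr (-2) * (\<Sum>m\<in>{2..Suc N}. 1 / (real m)^2)"
      unfolding sum_distrib_left
      by (intro sum.cong refl) (simp add: powr_mult powr_minus field_simps)
    also have "\<dots> \<le> real p powr (-2) * 1"
      using sum_inverse_squares_le[of N] by (intro mult_left_mono) (auto intro: order.trans)
    finally show ?thesis by simp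
  qed
  have "(\<Sum>n\<in>?A. real n powr (-2)) = (\<Sum>p\<in>?P. \<Sum>n\<in>{n\<in>?A. l n = p}. real n powr (-2))"
    by (rule sum.group[symmetric]) (use sub in auto)
  also have "\<dots> \<le> (\<Sum>p\<in>?P. real p powr (-2))" by (intro sum_mono part)
  finally show "(\<Sum>n | n \<in> A \<and> real n \<le> x. real n powr (-2)) \<le> (\<Sum>p | prime p \<and> real p \<le> x. real p powr (-2))"
    by (simp add: le_N)
qed

lemma closed_prime_sum_bound: "closed {\<sigma>. prime_sum_bound k \<sigma>}"
proof -
  have nz: "n > 0" if "n \<in> A" "lcm_primitive k A" for n A
    using that by (auto simp: lcm_primitive_def)
  have "{\<sigma>. prime_sum_bound k \<sigma>} = (\<Inter>(A, x)\<in>{(A, x). lcm_primitive k A \<and> x > 1}.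
     {\<sigma>. (\<Sum>n | n \<in> A \<and> real n \<le> x. real n powr (-\<sigma>)) \<le> (\<Sum>p | prime p \<and> real p \<le> x. real p powr (-\<sigma>))})"
    by (auto simp: prime_sum_bound_def)
  also have "closed \<dots>"
    by (intro closed_INT ballI, clarify, intro closed_Collect_le continuous_intros)
       (auto dest: nz prime_gt_0_nat)
  finally show ?thesis .
qed

theorem prime_sum_bound_iff:
  assumes "k \<ge> 1"
  shows "prime_sum_bound k \<sigma> \<longleftrightarrow> \<sigma> \<ge> lcm_critical_exponent k"
proof -
  let ?L = "{\<sigma>. prime_sum_bound k \<sigma>}"
  have bdd: "bdd_below ?L"
  proof (rule bdd_belowI[of _ "-2"])
    fix \<sigma> assume "\<sigma> \<in> ?L"
    then show "-2 \<le> \<sigma>"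
      using prime_sum_bound_mono[of k \<sigma> "-2"] not_prime_sum_bound_minus_two[of k] by force
  qed
  have "?L \<noteq> {}" using prime_sum_bound_two[OF assms] by auto
  then have "Inf ?L \<in> ?L" using bdd closed_prime_sum_bound by (rule closed_contains_Inf)
  then have *: "\<forall>\<sigma>. prime_sum_bound k \<sigma> \<longleftrightarrow> \<sigma> \<ge> Inf ?L"
    using prime_sum_bound_mono bdd by (auto intro: cInf_lower)
  have "\<forall>\<sigma>. prime_sum_bound k \<sigma> \<longleftrightarrow> \<sigma> \<ge> lcm_critical_exponent k"
    unfolding lcm_critical_exponent_def
  proof (rule theI[where P = "\<lambda>\<tau>. \<forall>\<sigma>. prime_sum_bound k \<sigma> \<longleftrightarrow> \<sigma> \<ge> \<tau>", OF *])
    fix \<tau> assume "\<forall>\<sigma>. prime_sum_bound k \<sigma> \<longleftrightarrow> \<sigma> \<ge> \<tau>"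
    with * show "\<tau> = Inf ?L" by (metis order.refl order.antisym)
  qed
  then show ?thesis by blast
qed

end

theory Submission
  imports Defs
begin

text \<open>
  Call a divisor \<open>d\<close> of \<open>n \<in> A\<close> private if it divides no other member of \<open>A\<close>. If \<open>n\<close> is a
  product of \<open>k\<close> pairwise coprime parts, then one of the parts is private: otherwise each part
  divides some other member, and \<open>n\<close> divides the lcm of these at most \<open>k\<close> members. The
  prime powers of \<open>n\<close> can be distributed over the \<open>k\<close> parts at will, and a distribution with
  minimal sum of parts is so well balanced (\<open>private_prime_power_or_balanced_divisor\<close>) that
  either the full power of some prime in \<open>n\<close> is private, or there is a private divisor \<open>v * w\<close>
  with a prime power \<open>v < w\<close>, and \<open>n\<close> is at least \<open>v * w * (w + 1) ^ (k - 1)\<close>.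

  Assign \<open>n\<close> to the prime of that prime power. A prime \<open>p \<in> A\<close> receives only \<open>p\<close> itself.
  A prime \<open>p \<notin> A\<close> receives at most one \<open>n\<close> of the first kind, and \<open>n \<ge> 2 * p\<close>, so this uses the
  portion \<open>2 powr (-\<sigma>)\<close> of \<open>p powr (-\<sigma>)\<close>. Members of the second kind are determined by
  \<open>(v, w)\<close>, so that their contribution is at most an explicit double sum over \<open>v = p ^ j\<close> and
  \<open>w > v\<close>, with summands roughly \<open>(v * w ^ k) powr (-\<sigma>)\<close>. Whenever this double sum fits into the
  remaining portion, the prime sum dominates (\<open>prime_sum_bound_if_fibre_bound\<close>).

  For \<open>k = 2\<close> and \<open>\<sigma> = 1\<close> the inner sum telescopes, and the resulting bound for the
  double sum meets the remaining portion exactly at \<open>p = 2\<close> and stays below it at the other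
  primes. For general \<open>k\<close>, comparison with an integral gives a sufficient condition in
  \<open>k * \<sigma>\<close> and \<open>\<sigma>\<close> (\<open>prime_sum_bound_criterion\<close>). For \<open>\<sigma> = 1.7 / ln P\<close> with
  \<open>P\<close> the \<open>k\<close>th prime it says that \<open>k / ln P\<close> is large enough compared with \<open>ln P\<close>, which is
  implied by a lower bound of Chebyshev type for the number \<open>k\<close> of primes up to \<open>P\<close>. That bound
  follows from \<open>2 ^ n \<le> lcm (1, ..., n + 1)\<close>, and suffices for \<open>ln P \<ge> 3.9\<close>. The remaining
  \<open>k\<close> are covered by the four exponents 2, 1, 0.65, 0.43 for \<open>k\<close> = 1, 2, 4, 7, because the
  critical exponent does not increase with \<open>k\<close>.

  The Erdos inequality follows from \<open>k = 2\<close>, \<open>\<sigma> = 1\<close> by partial summation against the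
  decreasing weight \<open>1 / ln n\<close>. To pass to infinite sums one needs that \<open>1 / (p * ln p)\<close> is
  summable over the primes, which follows from an upper bound of Chebyshev type on dyadic intervals.
\<close>

section \<open>Private divisors\<close>

definition private_divisor :: "nat set \<Rightarrow> nat \<Rightarrow> nat \<Rightarrow> bool" where
  "private_divisor A n d \<longleftrightarrow> d dvd n \<and> (\<forall>m\<in>A. d dvd m \<longrightarrow> m = n)"

lemma prod_dvd_if_pairwise_coprime:
  fixes u :: "'b \<Rightarrow> nat"
  assumes "finite I" "\<And>i. i \<in> I \<Longrightarrow> u i dvd d"
    and "\<And>i j. i \<in> I \<Longrightarrow> j \<in> I \<Longrightarrow> i \<noteq> j \<Longrightarrow> coprime (u i) (u j)"
  shows "(\<Prod>i\<in>I. u i) dvd d"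
  using assms
proof (induction I rule: finite_induct)
  case (insert i I)
  have "coprime (u i) (\<Prod>i\<in>I. u i)"
    using insert by (intro prod_coprime_right) auto
  moreover have "(\<Prod>i\<in>I. u i) dvd d" using insert by auto
  ultimately show ?case using insert by (auto intro: divides_mult)
qed simp

text \<open>
  If every part divided some other member, the lcm of these at most \<open>k\<close> members would be a
  multiple of all the parts, hence of their product \<open>n\<close>.
\<close>

lemma private_part_exists:
  assumes A: "lcm_primitive k A" and n: "n \<in> A" and k: "k \<ge> 1"
    and prod: "n = (\<Prod>i<k. u i)"
    and cop: "\<And>i j. i < k \<Longrightarrow> j < k \<Longrightarrow> i \<noteq> j \<Longrightarrow> coprime (u i) (u j)"
  shows "\<exists>i<k. private_divisor A n (u i)"
proof (rule ccontr)
  assume "\<not> ?thesis"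
  moreover have "u i dvd n" if "i < k" for i
    unfolding prod using that by (intro dvd_prodI) auto
  ultimately have "\<forall>i<k. \<exists>m\<in>A. u i dvd m \<and> m \<noteq> n"
    unfolding private_divisor_def by blast
  then obtain m where m: "\<And>i. i < k \<Longrightarrow> m i \<in> A \<and> u i dvd m i \<and> m i \<noteq> n" by metis
  let ?S = "m ` {..<k}"
  have "card ?S \<le> k" using card_image_le[of "{..<k}" m] by simp
  moreover have "1 \<le> card ?S"
    using k by (simp add: Suc_le_eq card_gt_0_iff lessThan_empty_iff)
  moreover have "?S \<subseteq> A - {n}" using m by auto
  moreover have "n dvd Lcm ?S"
    unfolding prod using cop m
    by (intro prod_dvd_if_pairwise_coprime) (auto intro: dvd_trans[OF _ dvd_Lcm])
  ultimately show False using A n unfolding lcm_primitive_def by blast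
qed

text \<open>
  Among all distributions of the prime powers of \<open>n\<close> over \<open>k\<close> parts, take one with the least
  sum of the parts, and let \<open>u\<close> be a private part. If \<open>u\<close> has at least two prime factors, write
  \<open>u = v * w\<close> with \<open>v\<close> its smallest prime power. Moving \<open>v\<close> to another part \<open>u'\<close> replaces
  \<open>v * w + u'\<close> by \<open>w + v * u'\<close>, so minimality forces \<open>w \<le> u'\<close>, and coprimality excludes
  equality. Hence every other part is at least \<open>w + 1\<close>.
\<close>

lemma private_prime_power_or_balanced_divisor:
  assumes A: "lcm_primitive k A" and n: "n \<in> A" and k: "k \<ge> 1"
  obtains p where "prime p" "p dvd n" "private_divisor A n (p ^ multiplicity p n)"
  | p j w where "prime p" "j \<ge> 1" "p ^ j < w" "private_divisor A n (p ^ j * w)"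
      "p ^ j * w * (w + 1) ^ (k - 1) \<le> n"
proof -
  have n1: "n > 1" using A n by (auto simp: lcm_primitive_def)
  define q where "q p = p ^ multiplicity p n" for p
  define F where "F = prime_factors n"
  define part where "part f i = (\<Prod>p\<in>{p\<in>F. f p = i}. q p)" for f and i :: nat
  have finF: "finite F" by (simp add: F_def)
  have F: "prime p" "p dvd n" "1 \<le> multiplicity p n" if "p \<in> F" for p
    using that unfolding F_def
    by (auto dest: in_prime_factors_imp_prime in_prime_factors_imp_dvd)
      (simp add: prime_factors_multiplicity Suc_le_eq)
  have q0: "q p > 0" if "p \<in> F" for p
    using F(1)[OF that] by (simp add: q_def prime_gt_0_nat)
  have q1: "q p > 1" if "p \<in> F" for p
    unfolding q_def using F(1,3)[OF that] by (intro one_less_power prime_gt_1_nat) auto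
  have qc: "coprime (q p) (q p')" if "p \<in> F" "p' \<in> F" "p \<noteq> p'" for p p'
    unfolding q_def using primes_coprime[OF F(1) F(1), of p p'] that by simp
  have part_pos: "part f i > 0" for f i
    unfolding part_def using q0 by (intro prod_pos) auto
  have cop: "coprime (part f i) (part f l)" if "i \<noteq> l" for f i l
    unfolding part_def using that by (intro prod_coprime_left prod_coprime_right qc) auto
  have prod: "n = (\<Prod>i<k. part f i)" if "\<forall>p\<in>F. f p < k" for f
  proof -
    have "(\<Prod>i<k. part f i) = (\<Prod>p\<in>F. q p)"
      unfolding part_def using that finF by (intro prod.group) auto
    also have "\<dots> = n" unfolding F_def q_def using n1 by (intro prime_factorization_nat[symmetric]) auto
    finally show ?thesis by simp
  qed
  \<comment> \<open>A function \<open>f\<close> with values below \<open>k\<close> encodes a distribution of the primes of \<open>n\<close> over the parts.\<close>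
  have "\<exists>f. (\<forall>p\<in>F. f p < k) \<and> (\<forall>g. (\<forall>p\<in>F. g p < k) \<longrightarrow> (\<Sum>i<k. part f i) \<le> (\<Sum>i<k. part g i))"
    by (rule ex_has_least_nat[of "\<lambda>f. \<forall>p\<in>F. f p < k" "\<lambda>_. 0"]) (use k in auto)
  then obtain f where f: "\<forall>p\<in>F. f p < k"
    and fmin: "\<And>g. \<forall>p\<in>F. g p < k \<Longrightarrow> (\<Sum>i<k. part f i) \<le> (\<Sum>i<k. part g i)" by blast
  obtain i where i: "i < k" "private_divisor A n (part f i)"
    using private_part_exists[OF A n k prod[OF f]] cop by blast
  define G where "G = {p\<in>F. f p = i}"
  have finG: "finite G" using finF by (simp add: G_def)
  have GF: "G \<subseteq> F" by (auto simp: G_def)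
  show thesis
  \<comment> \<open>This case includes an empty \<open>G\<close>: the part is then 1, and every divisor of \<open>n\<close>
    that is a multiple of a private divisor is private too.\<close>
  proof (cases "\<exists>p\<in>F. G \<subseteq> {p}")
    case True
    then obtain p where p: "p \<in> F" "G \<subseteq> {p}" by blast
    have "part f i dvd (\<Prod>p\<in>{p}. q p)"
      unfolding part_def using p by (intro prod_dvd_prod_subset) (auto simp: G_def)
    then have "part f i dvd q p" by simp
    moreover have "q p dvd n" unfolding q_def by (rule multiplicity_dvd)
    ultimately have "private_divisor A n (q p)"
      using i(2) unfolding private_divisor_def by (meson dvd_trans)
    then show thesis using that(1) F[OF p(1)] unfolding q_def by blast
  next
    case False
    have "F \<noteq> {}" using n1 by (auto simp: F_def prime_factorization_empty_iff)
    then have "G \<noteq> {}" using False by auto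
    then obtain p where p: "p \<in> G" and pmin: "\<And>p'. p' \<in> G \<Longrightarrow> q p \<le> q p'"
      using finG arg_min_if_finite[of G q] by (metis not_le)
    define w where "w = (\<Prod>p\<in>G - {p}. q p)"
    have pF: "p \<in> F" using p GF by blast
    have part_i: "part f i = q p * w"
      unfolding part_def w_def G_def[symmetric] using p finG by (rule prod.remove[rotated])
    have w0: "w > 0" unfolding w_def using q0 GF by (intro prod_pos) auto
    obtain p' where p': "p' \<in> G" "p' \<noteq> p" using False pF by blast
    have "q p' dvd w" unfolding w_def using p' finG by (intro dvd_prodI) auto
    then have "q p' \<le> w" using w0 by (rule dvd_imp_le)
    moreover have "q p \<noteq> q p'"
      using qc[of p p'] p' pF GF q1[of p]
      by (metis coprime_self nat_dvd_1_iff_1 less_irrefl subsetD is_unit_gcd coprime_def dvd_refl)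
    ultimately have qw: "q p < w" using pmin[OF p'(1)] by linarith
    have other: "w + 1 \<le> part f l" if l: "l < k" "l \<noteq> i" for l
    proof -
      define g where "g = f(p := l)"
      have g: "\<forall>p\<in>F. g p < k" using f l by (auto simp: g_def)
      have gi: "part g i = w"
        unfolding part_def w_def using l by (intro prod.cong) (auto simp: g_def G_def)
      have "{p'\<in>F. g p' = l} = insert p {p'\<in>F. f p' = l}" using pF by (auto simp: g_def)
      moreover have "p \<notin> {p'\<in>F. f p' = l}" using p l by (auto simp: G_def)
      ultimately have gl: "part g l = q p * part f l"
        unfolding part_def using finF by simp
      have rest: "part g m = part f m" if "m \<noteq> i" "m \<noteq> l" for m
        unfolding part_def using that p by (intro prod.cong) (auto simp: g_def G_def)
      have split: "(\<Sum>m<k. part h m) = part h i + (part h l + (\<Sum>m\<in>{..<k} - {i} - {l}. part h m))" for h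
        using i(1) l by (subst sum.remove[of _ i], simp, simp, subst sum.remove[of _ l]) auto
      have "(\<Sum>m\<in>{..<k} - {i} - {l}. part g m) = (\<Sum>m\<in>{..<k} - {i} - {l}. part f m)"
        by (intro sum.cong rest) auto
      then have "q p * w + part f l \<le> w + q p * part f l"
        using fmin[OF g] unfolding split gi gl part_i by linarith
      moreover obtain c where c: "q p = c + 2"
        using q1[OF pF] by (metis add.commute less_eqE one_add_one Suc_eq_plus1 Suc_leI)
      ultimately have "(c + 1) * w \<le> (c + 1) * part f l" by (simp add: algebra_simps)
      then have "w \<le> part f l" by (rule mult_left_le_imp_le) simp
      moreover have "w \<noteq> part f l"
      proof
        assume eq: "w = part f l"
        have "coprime (q p * w) w" using cop[of i l f] l eq part_i by simp
        then show False using qw q0[OF pF] by simp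
      qed
      ultimately show ?thesis by simp
    qed
    have "p ^ multiplicity p n * w * (w + 1) ^ (k - 1) = part f i * (\<Prod>l\<in>{..<k} - {i}. w + 1)"
      using i(1) by (simp add: part_i q_def)
    also have "\<dots> \<le> part f i * (\<Prod>l\<in>{..<k} - {i}. part f l)"
      using other by (intro mult_left_mono prod_mono) auto
    also have "\<dots> = (\<Prod>l<k. part f l)" using i(1) by (subst (2) prod.remove[of _ i]) auto
    also have "\<dots> = n" using prod[OF f] by simp
    finally have "p ^ multiplicity p n * w * (w + 1) ^ (k - 1) \<le> n" .
    then show thesis
      using that(2)[of p "multiplicity p n" w] F[OF pF] qw i(2) part_i unfolding q_def by simp
  qed
qed

section \<open>Reducing to one inequality for each prime\<close>

text \<open>
  The left side of the hypothesis bounds the contribution of the members that are assigned to \<open>p\<close>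
  through a divisor \<open>p ^ j * w\<close>; the factor \<open>1 - 2 powr (-\<sigma>)\<close> is what the at most one
  member with a private power of \<open>p\<close> leaves over when \<open>p \<notin> A\<close>.
\<close>

lemma prime_sum_bound_if_fibre_bound:
  assumes k: "k \<ge> 1" and lam: "\<sigma> > 0"
    and H: "\<And>p N. prime p \<Longrightarrow>
      (\<Sum>j=1..N. \<Sum>w\<in>{p^j<..N}. real (p ^ j * w * (w + 1) ^ (k - 1)) powr (-\<sigma>))
        \<le> (1 - 2 powr (-\<sigma>)) * real p powr (-\<sigma>)"
  shows "prime_sum_bound k \<sigma>"
  unfolding prime_sum_bound_def
proof (intro allI impI, elim conjE)
  fix A and x :: real assume A: "lcm_primitive k A" and x: "x > 1"
  define N where "N = nat \<lfloor>x\<rfloor>"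
  have le_N: "real n \<le> x \<longleftrightarrow> n \<le> N" for n
    using x unfolding N_def by linarith
  have A1: "n > 1" if "n \<in> A" for n using A that by (auto simp: lcm_primitive_def)
  have prim: "n = m" if "n \<in> A" "m \<in> A" "n dvd m" for n m
  proof (rule ccontr)
    assume "n \<noteq> m"
    then have "{m} \<subseteq> A - {n} \<and> finite {m} \<and> 1 \<le> card {m} \<and> card {m} \<le> k" using that k by auto
    then have "\<not> n dvd Lcm {m}" using A that(1) unfolding lcm_primitive_def by blast
    then show False using that by simp
  qed
  define C where "C n \<longleftrightarrow> (\<exists>p. prime p \<and> p dvd n \<and> private_divisor A n (p ^ multiplicity p n))" for n
  define G where "G p j w = p ^ j * w * (w + 1) ^ (k - 1)" for p j w :: nat
  have "\<exists>p j w. prime p \<and> p dvd n \<and>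
      (if C n then private_divisor A n (p ^ multiplicity p n)
       else j \<ge> 1 \<and> p ^ j < w \<and> private_divisor A n (p ^ j * w) \<and> G p j w \<le> n)"
    if n: "n \<in> A" for n
  proof (rule private_prime_power_or_balanced_divisor[OF A n k])
    fix p j w assume a: "prime p" "j \<ge> 1" "p ^ j < w" "private_divisor A n (p ^ j * w)"
      "p ^ j * w * (w + 1) ^ (k - 1) \<le> n"
    have "p dvd n" using a(2,4) unfolding private_divisor_def
      by (metis dvd_mult_left dvd_power dvd_trans not_one_le_zero zero_less_iff_neq_zero)
    then show ?thesis using a by (cases "C n") (auto simp: C_def G_def)
  qed (auto simp: C_def)
  then obtain h J W where hJW: "\<And>n. n \<in> A \<Longrightarrow> prime (h n) \<and> h n dvd n \<and>
      (if C n then private_divisor A n (h n ^ multiplicity (h n) n)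
       else J n \<ge> 1 \<and> h n ^ J n < W n \<and> private_divisor A n (h n ^ J n * W n) \<and> G (h n) (J n) (W n) \<le> n)"
    by metis
  let ?X = "{n. n \<in> A \<and> n \<le> N}" and ?P = "{p. prime p \<and> p \<le> N}"
  have sub: "h ` ?X \<subseteq> ?P"
  proof
    fix p assume "p \<in> h ` ?X"
    then obtain n where n: "n \<in> A" "n \<le> N" "p = h n" by auto
    have "h n \<le> n" using hJW[OF n(1)] A1[OF n(1)] by (intro dvd_imp_le) auto
    then show "p \<in> ?P" using n hJW[OF n(1)] by simp
  qed
  have fibre: "(\<Sum>n\<in>{n\<in>?X. h n = p}. real n powr (-\<sigma>)) \<le> real p powr (-\<sigma>)" if p: "p \<in> ?P" for p
  proof (cases "p \<in> A")
    case True
    have "{n\<in>?X. h n = p} \<subseteq> {p}" 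
    proof
      fix n assume "n \<in> {n\<in>?X. h n = p}"
      then have "n \<in> A" "p dvd n" using hJW[of n] by auto
      then show "n \<in> {p}" using prim[OF True] by auto
    qed
    then have "(\<Sum>n\<in>{n\<in>?X. h n = p}. real n powr (-\<sigma>)) \<le> (\<Sum>n\<in>{p}. real n powr (-\<sigma>))"
      by (intro sum_mono2) auto
    then show ?thesis by simp
  next
    case False
    have pp: "prime p" "p > 0" using p prime_gt_0_nat by auto
    define E1 where "E1 = {n\<in>?X. h n = p \<and> C n}"
    define E2 where "E2 = {n\<in>?X. h n = p \<and> \<not> C n}"
    have E: "{n\<in>?X. h n = p} = E1 \<union> E2" "E1 \<inter> E2 = {}" by (auto simp: E1_def E2_def)
    have fin: "finite E1" "finite E2" by (simp_all add: E1_def E2_def)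
    have s1: "(\<Sum>n\<in>E1. real n powr (-\<sigma>)) \<le> 2 powr (-\<sigma>) * real p powr (-\<sigma>)"
    proof (cases "E1 = {}")
      case False
      then obtain n where n: "n \<in> E1" by auto
      \<comment> \<open>Of two powers of \<open>p\<close> the smaller divides the larger, so they cannot be private for
        two different members.\<close>
      have "m = n" if m: "m \<in> E1" for m
      proof -
        have nm: "n \<in> A" "m \<in> A" "private_divisor A n (p ^ multiplicity p n)"
          "private_divisor A m (p ^ multiplicity p m)"
          using n m hJW[of n] hJW[of m] by (auto simp: E1_def)
        have "p ^ multiplicity p n dvd m \<or> p ^ multiplicity p m dvd n"
          by (cases "multiplicity p n" "multiplicity p m" rule: linorder_cases)
            (auto intro: multiplicity_dvd')
        then show ?thesis using nm unfolding private_divisor_def by blast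
      qed
      then have E1: "E1 = {n}" using n by blast
      have n': "n \<in> A" "p dvd n" using n hJW by (auto simp: E1_def)
      then obtain c where c: "n = p * c" by (elim dvdE)
      have "c \<noteq> 0" using c A1[OF n'(1)] by (intro notI) simp
      moreover have "c \<noteq> 1" using c n'(1) \<open>p \<notin> A\<close> by (intro notI) simp
      ultimately have "2 * p \<le> n" using c by simp
      then have "real n powr (-\<sigma>) \<le> real (2 * p) powr (-\<sigma>)"
        using pp lam by (intro powr_mono2') auto
      then show ?thesis unfolding E1 by (simp add: powr_mult)
    qed simp
    \<comment> \<open>A private divisor determines the member it belongs to.\<close>
    have inj: "inj_on (\<lambda>n. (J n, W n)) E2"
    proof (rule inj_onI)
      fix n m assume "n \<in> E2" "m \<in> E2" and eq: "(J n, W n) = (J m, W m)"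
      then have "private_divisor A n (p ^ J n * W n)" "private_divisor A m (p ^ J n * W n)" "n \<in> A" "m \<in> A"
        using hJW[of n] hJW[of m] by (auto simp: E2_def)
      then show "n = m" unfolding private_divisor_def by blast
    qed
    have "(\<Sum>n\<in>E2. real n powr (-\<sigma>)) \<le> (\<Sum>n\<in>E2. real (G p (J n) (W n)) powr (-\<sigma>))"
    proof (rule sum_mono)
      fix n assume n: "n \<in> E2"
      then have "G p (J n) (W n) \<le> n" "p ^ J n < W n" using hJW[of n] by (auto simp: E2_def)
      moreover from this have "G p (J n) (W n) > 0" using pp by (auto simp: G_def)
      ultimately show "real n powr (-\<sigma>) \<le> real (G p (J n) (W n)) powr (-\<sigma>)"
        using lam by (intro powr_mono2') auto
    qed
    also have "\<dots> = (\<Sum>(j,w)\<in>(\<lambda>n. (J n, W n)) ` E2. real (G p j w) powr (-\<sigma>))"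
      by (subst sum.reindex[OF inj]) simp
    also have "\<dots> \<le> (\<Sum>(j,w)\<in>(SIGMA j:{1..N}. {p^j<..N}). real (G p j w) powr (-\<sigma>))"
    proof (rule sum_mono2)
      show "(\<lambda>n. (J n, W n)) ` E2 \<subseteq> (SIGMA j:{1..N}. {p^j<..N})"
      proof (clarsimp simp: Suc_le_eq)
        fix n assume n: "n \<in> E2"
        then have *: "J n \<ge> 1" "p ^ J n < W n" "p ^ J n * W n dvd n" "n \<le> N" "n > 1"
          using hJW[of n] A1 by (auto simp: E2_def private_divisor_def)
        have "W n \<le> n" using dvd_imp_le[of "W n" n] * by (meson dvd_mult_right less_trans zero_less_one)
        moreover have "J n < p ^ J n" using prime_gt_1_nat[OF pp(1)] by (intro power_gt_expt) auto
        ultimately show "0 < J n \<and> J n \<le> N \<and> p ^ J n < W n \<and> W n \<le> N" using * by linarith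
      qed
    qed auto
    also have "\<dots> = (\<Sum>j=1..N. \<Sum>w\<in>{p^j<..N}. real (G p j w) powr (-\<sigma>))"
      by (subst sum.Sigma) auto
    also have "\<dots> \<le> (1 - 2 powr (-\<sigma>)) * real p powr (-\<sigma>)"
      unfolding G_def by (rule H[OF pp(1)])
    finally have s2: "(\<Sum>n\<in>E2. real n powr (-\<sigma>)) \<le> (1 - 2 powr (-\<sigma>)) * real p powr (-\<sigma>)" .
    show ?thesis unfolding E(1) sum.union_disjoint[OF fin E(2)]
      using s1 s2 by (simp add: algebra_simps)
  qed
  have "(\<Sum>n\<in>?X. real n powr (-\<sigma>)) = (\<Sum>p\<in>?P. \<Sum>n\<in>{n\<in>?X. h n = p}. real n powr (-\<sigma>))"
    by (rule sum.group[symmetric]) (use sub in auto)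
  also have "\<dots> \<le> (\<Sum>p\<in>?P. real p powr (-\<sigma>))" by (intro sum_mono fibre)
  finally show "(\<Sum>n | n \<in> A \<and> real n \<le> x. real n powr (-\<sigma>)) \<le> (\<Sum>p | prime p \<and> real p \<le> x. real p powr (-\<sigma>))"
    by (simp add: le_N)
qed

section \<open>The exponent 1 for lcm 2-primitive sets\<close>

lemma geometric_partial_sum_le:
  fixes r :: real
  assumes "0 \<le> r" "r < 1"
  shows "(\<Sum>j=1..N. r ^ j) \<le> r / (1 - r)"
proof -
  have "(1 - r) * (\<Sum>j=1..N. r ^ j) = r - r ^ Suc N"
  proof (induction N)
    case (Suc N)
    have "(1 - r) * (\<Sum>j=1..Suc N. r ^ j) = (1 - r) * (\<Sum>j=1..N. r ^ j) + (1 - r) * r ^ Suc N"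
      by (simp add: distrib_left)
    also have "\<dots> = r - r ^ Suc (Suc N)" unfolding Suc.IH by (simp add: algebra_simps)
    finally show ?case .
  qed simp
  then have "(\<Sum>j=1..N. r ^ j) = (r - r ^ Suc N) / (1 - r)"
    using assms by (simp add: eq_divide_eq mult.commute)
  also have "\<dots> \<le> r / (1 - r)" using assms by (intro divide_right_mono) auto
  finally show ?thesis .
qed

lemma telescoping_tail_le: "(\<Sum>w\<in>{v<..N}. 1 / (real w * (real w + 1))) \<le> 1 / (real v + 1)"
proof (cases "v \<le> N")
  case True
  then have "(\<Sum>w\<in>{v<..N}. 1 / (real w * (real w + 1))) = 1 / (real v + 1) - 1 / (real N + 1)"
  proof (induction N rule: dec_induct)
    case (step n)
    have "{v<..Suc n} = insert (Suc n) {v<..n}" using step by auto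
    moreover have "1 / (real (Suc n) * (real (Suc n) + 1)) = 1 / (real n + 1) - 1 / (real (Suc n) + 1)"
      by (simp add: divide_simps)
    ultimately show ?case using step.IH by simp
  qed simp
  then show ?thesis by simp
qed simp

text \<open>
  The inner sum is at most \<open>1 / (v + 1)\<close>, and it remains to see that the sum of
  \<open>1 / (v * (v + 1))\<close> over the powers \<open>v\<close> of \<open>p\<close> is at most \<open>1 / (2 * p)\<close>. Replacing
  \<open>v + 1\<close> by \<open>v\<close> in all terms is too lossy for \<open>p = 2\<close>; keeping the first term exact and
  bounding the others by a geometric series gives exactly \<open>1 / 4\<close> there.
\<close>

lemma prime_sum_bound_2_1: "prime_sum_bound 2 1"
proof (rule prime_sum_bound_if_fibre_bound)
  fix p N :: nat assume p: "prime p"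
  define P where "P = real p"
  have P: "P \<ge> 2" using prime_ge_2_nat[OF p] by (simp add: P_def)
  define r where "r = 1 / P^2"
  have r: "0 \<le> r" "r < 1" using P by (auto simp: r_def)
  have "(\<Sum>j=1..N. \<Sum>w\<in>{p^j<..N}. real (p ^ j * w * (w + 1) ^ (2 - 1)) powr (-1))
      = (\<Sum>j=1..N. 1 / P^j * (\<Sum>w\<in>{p^j<..N}. 1 / (real w * (real w + 1))))"
    by (simp add: sum_distrib_left powr_minus_divide P_def algebra_simps)
  also have "\<dots> \<le> (\<Sum>j=1..N. 1 / P^j * (1 / (P^j + 1)))"
    using telescoping_tail_le[of "p ^ _" N] P
    by (intro sum_mono mult_left_mono) (auto simp: P_def)
  also have "\<dots> \<le> (\<Sum>j=1..N. r^j - (if j = 1 then r - 1 / (P * (P + 1)) else 0))"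
  proof (rule sum_mono)
    fix j assume "j \<in> {1..N}"
    have "1 / P^j * (1 / (P^j + 1)) \<le> 1 / P^j * (1 / P^j)"
      using P by (intro mult_left_mono divide_left_mono mult_pos_pos add_pos_pos zero_less_power) auto
    also have "\<dots> = r^j" by (simp add: r_def power_divide power2_eq_square power_mult_distrib)
    finally show "1 / P^j * (1 / (P^j + 1)) \<le> r^j - (if j = 1 then r - 1 / (P * (P + 1)) else 0)" by auto
  qed
  also have "\<dots> \<le> 1 / (2 * P)"
  proof (cases "N = 0")
    case False
    have "(\<Sum>j=1..N. r^j - (if j = 1 then r - 1 / (P * (P + 1)) else 0))
        = (\<Sum>j=1..N. r^j) - (r - 1 / (P * (P + 1)))"
      using False by (simp add: sum_subtractf)
    also have "\<dots> \<le> r / (1 - r) - (r - 1 / (P * (P + 1)))"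
      using geometric_partial_sum_le[OF r] by simp
    also have "\<dots> \<le> 1 / (2 * P)"
    proof -
      have nz: "P \<noteq> 0" "P + 1 > 0" "P - 1 > 0" using P by auto
      have "P^2 > 1" using P by (intro one_less_power) auto
      then have "r / (1 - r) = 1 / (P^2 - 1)" "P * P \<noteq> 1"
        using nz by (simp_all add: r_def divide_simps power2_eq_square)
      moreover have "P^2 - 1 = (P - 1) * (P + 1)" by (simp add: power2_eq_square algebra_simps)
      ultimately have "r / (1 - r) = 1 / ((P - 1) * (P + 1))" by simp
      moreover have "1 / (2 * P) - (1 / ((P - 1) * (P + 1)) - (1 / P^2 - 1 / (P * (P + 1))))
          = ((P - 2) * (P^2 + 1)) / (2 * P^2 * (P - 1) * (P + 1))"
        using nz by (simp add: divide_simps power2_eq_square) (simp add: algebra_simps)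
      \<comment> \<open>The factor \<open>P - 2\<close> shows that the estimate is sharp at \<open>P = 2\<close>.\<close>
      ultimately have "1 / (2 * P) - (r / (1 - r) - (r - 1 / (P * (P + 1))))
          = ((P - 2) * (P^2 + 1)) / (2 * P^2 * (P - 1) * (P + 1))"
        by (simp add: r_def)
      also have "\<dots> \<ge> 0" using P by (intro divide_nonneg_nonneg mult_nonneg_nonneg) auto
      finally show ?thesis by simp
    qed
    finally show ?thesis .
  qed (use P in auto)
  also have "\<dots> = (1 - 2 powr (-1)) * real p powr (-1)"
    using P by (simp add: powr_minus_divide P_def)
  finally show "(\<Sum>j=1..N. \<Sum>w\<in>{p^j<..N}. real (p ^ j * w * (w + 1) ^ (2 - 1)) powr (-1))
      \<le> (1 - 2 powr (-1)) * real p powr (-1)" .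
qed auto

section \<open>A sufficient condition on k and the exponent\<close>

text \<open>
  The right side is the integral of \<open>x powr (-K)\<close> over \<open>x \<ge> v\<close>. Each term is bounded by
  the increment of the antiderivative over \<open>[w - 1, w]\<close>, which reduces to
  \<open>1 + (K - 1) / x \<le> (1 - 1 / x) powr (1 - K)\<close>.
\<close>

lemma powr_tail_le:
  assumes "K > 1" "v \<ge> 1"
  shows "(\<Sum>w\<in>{v<..N}. real w powr (-K)) \<le> real v powr (1 - K) / (K - 1)"
proof -
  have powr_step: "real (Suc w) powr (-K) \<le> (real w powr (1 - K) - real (Suc w) powr (1 - K)) / (K - 1)"
    if w: "w \<ge> 1" for w
  proof -
    define x where "x = real (Suc w)"
    have x: "x > 1" using w by (simp add: x_def)
    have "1 + (K - 1) / x \<le> exp ((K - 1) / x)" by (rule exp_ge_add_one_self)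
    also have "\<dots> \<le> exp ((1 - K) * ln (1 - 1 / x))"
    proof -
      have "ln (1 - 1 / x) \<le> - (1 / x)" using ln_le_minus_one[of "1 - 1 / x"] x by simp
      then have "(K - 1) * (1 / x) \<le> (K - 1) * (- ln (1 - 1 / x))"
        using assms by (intro mult_left_mono) auto
      then show ?thesis by (simp add: algebra_simps)
    qed
    also have "\<dots> = (1 - 1 / x) powr (1 - K)" using x by (simp add: powr_def)
    finally have "(1 + (K - 1) / x) * x powr (1 - K) \<le> (1 - 1 / x) powr (1 - K) * x powr (1 - K)"
      by (intro mult_right_mono) auto
    also have "\<dots> = (x - 1) powr (1 - K)" using x by (simp add: algebra_simps flip: powr_mult)
    finally have "(K - 1) * (x powr (1 - K) / x) \<le> (x - 1) powr (1 - K) - x powr (1 - K)"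
      by (simp add: algebra_simps)
    moreover have "x powr (1 - K) / x = x powr (-K)"
      using x by (simp add: powr_diff powr_minus_divide)
    ultimately have "x powr (-K) \<le> ((x - 1) powr (1 - K) - x powr (1 - K)) / (K - 1)"
      using assms by (simp add: pos_le_divide_eq mult.commute)
    then show ?thesis by (simp add: x_def)
  qed
  show ?thesis
  proof (cases "v \<le> N")
    case True
    then have "(\<Sum>w\<in>{v<..N}. real w powr (-K)) \<le> (real v powr (1 - K) - real N powr (1 - K)) / (K - 1)"
    proof (induction N rule: dec_induct)
      case (step n)
      have "{v<..Suc n} = insert (Suc n) {v<..n}" using step by auto
      then have "(\<Sum>w\<in>{v<..Suc n}. real w powr (-K))
          = real (Suc n) powr (-K) + (\<Sum>w\<in>{v<..n}. real w powr (-K))" by simp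
      also have "\<dots> \<le> (real n powr (1 - K) - real (Suc n) powr (1 - K)) / (K - 1)
          + (real v powr (1 - K) - real n powr (1 - K)) / (K - 1)"
        using step assms by (intro add_mono powr_step) auto
      also have "\<dots> = (real v powr (1 - K) - real (Suc n) powr (1 - K)) / (K - 1)"
        by (simp flip: add_divide_distrib)
      finally show ?case .
    qed simp
    also have "\<dots> \<le> real v powr (1 - K) / (K - 1)"
      using assms by (intro divide_right_mono) auto
    finally show ?thesis .
  qed (use assms in simp)
qed

text \<open>
  Convexity of \<open>\<lambda>s. (1/2) powr s\<close> between 0 and 1, in the form of Young's inequality.
\<close>

lemma one_minus_two_powr_ge:
  assumes "0 \<le> \<sigma>" "\<sigma> \<le> (1::real)"
  shows "1 - 2 powr (-\<sigma>) \<ge> \<sigma> / 2"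
proof -
  have "(1/2) powr \<sigma> * 1 powr (1 - \<sigma>) \<le> \<sigma> * (1/2) + (1 - \<sigma>) * 1"
    using assms by (intro Youngs_inequality_0) auto
  then show ?thesis by (simp add: powr_divide powr_minus_divide)
qed

text \<open>
  With \<open>K = k * \<sigma>\<close>, the inner sum over \<open>w\<close> is at most
  \<open>v powr (1 - K - \<sigma>) / (K - 1)\<close>, and summing over \<open>v = p ^ j\<close> gives a geometric series with
  ratio \<open>p powr (-\<sigma>) / p powr (K - 1)\<close>. Relative to \<open>p powr (-\<sigma>)\<close> the result decreases
  in \<open>p\<close>, so \<open>p = 2\<close> is decisive, and \<open>1 - 2 powr (-\<sigma>) \<ge> \<sigma> / 2\<close> makes the condition simple.
\<close>

lemma prime_sum_bound_criterion:
  assumes k: "k \<ge> 1" and \<sigma>: "0 < \<sigma>" "\<sigma> \<le> 1" and K1: "real k * \<sigma> > 1"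
    and crit: "(real k * \<sigma> - 1) * (\<sigma> / 2) * (2 powr (real k * \<sigma> - 1) - 1) \<ge> 1"
  shows "prime_sum_bound k \<sigma>"
proof (rule prime_sum_bound_if_fibre_bound[OF k \<sigma>(1)])
  fix p N :: nat assume p: "prime p"
  define K where "K = real k * \<sigma>"
  define P where "P = real p"
  have P: "P \<ge> 2" using prime_ge_2_nat[OF p] by (simp add: P_def)
  have K: "K > 1" using K1 by (simp add: K_def)
  define a b B where "a = P powr (-\<sigma>)" and "b = P powr (K - 1)" and "B = 2 powr (K - 1)"
  define r where "r = P powr (1 - K - \<sigma>)"
  have a: "0 < a" "a \<le> 1"
    using P \<sigma> powr_mono[of "-\<sigma>" 0 P] by (auto simp: a_def)
  have B: "1 < B" "B \<le> b"
    unfolding B_def b_def using K P by (auto intro: powr_mono2)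
  have r: "r = a / b"
    using P by (simp add: r_def a_def b_def algebra_simps flip: powr_diff)
  have r01: "0 \<le> r" "r < 1" using a B by (auto simp: r)
  have inner: "(\<Sum>w\<in>{p^j<..N}. real (p ^ j * w * (w + 1) ^ (k - 1)) powr (-\<sigma>)) \<le> r ^ j / (K - 1)"
    for j
  proof -
    define v where "v = p ^ j"
    have v: "v \<ge> 1" using p by (simp add: v_def prime_gt_0_nat Suc_le_eq)
    have vr: "real v powr s = (P powr s) ^ j" for s
      using P by (simp add: v_def P_def powr_powr mult.commute flip: powr_realpow)
    have "(\<Sum>w\<in>{v<..N}. real (v * w * (w + 1) ^ (k - 1)) powr (-\<sigma>))
        \<le> (\<Sum>w\<in>{v<..N}. real v powr (-\<sigma>) * real w powr (-K))"
    proof (rule sum_mono)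
      fix w assume "w \<in> {v<..N}"
      then have w: "w > 0" by auto
      have "v * w ^ k = v * w * w ^ (k - 1)"
        using k by (simp add: power_eq_if)
      also have "\<dots> \<le> v * w * (w + 1) ^ (k - 1)" by (intro mult_left_mono power_mono) auto
      finally have "real (v * w ^ k) \<le> real (v * w * (w + 1) ^ (k - 1))" by (rule of_nat_mono)
      then have "real (v * w * (w + 1) ^ (k - 1)) powr (-\<sigma>) \<le> real (v * w ^ k) powr (-\<sigma>)"
        using v w \<sigma> by (intro powr_mono2') auto
      also have "\<dots> = real v powr (-\<sigma>) * real w powr (-K)"
        using w by (simp add: powr_mult K_def powr_powr flip: powr_realpow)
      finally show "real (v * w * (w + 1) ^ (k - 1)) powr (-\<sigma>) \<le> real v powr (-\<sigma>) * real w powr (-K)" .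
    qed
    also have "\<dots> \<le> real v powr (-\<sigma>) * (real v powr (1 - K) / (K - 1))"
      unfolding sum_distrib_left[symmetric] by (intro mult_left_mono powr_tail_le K v) auto
    also have "\<dots> = real v powr (1 - K - \<sigma>) / (K - 1)"
      by (simp flip: powr_add)
    also have "\<dots> = r ^ j / (K - 1)" by (simp add: vr r_def)
    finally show ?thesis by (simp add: v_def)
  qed
  have "(\<Sum>j=1..N. \<Sum>w\<in>{p^j<..N}. real (p ^ j * w * (w + 1) ^ (k - 1)) powr (-\<sigma>))
      \<le> (\<Sum>j=1..N. r ^ j / (K - 1))"
    by (intro sum_mono inner)
  also have "\<dots> = (\<Sum>j=1..N. r ^ j) / (K - 1)" by (simp add: sum_divide_distrib)
  also have "\<dots> \<le> r / (1 - r) / (K - 1)"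
    using K by (intro divide_right_mono geometric_partial_sum_le r01) auto
  also have "r / (1 - r) = a / (b - a)" using a B by (simp add: r field_simps)
  also have "a / (b - a) / (K - 1) \<le> a / (B - 1) / (K - 1)"
    using a B K by (intro divide_right_mono divide_left_mono mult_pos_pos) auto
  also have "\<dots> \<le> (\<sigma> / 2) * a"
  proof -
    have "1 * a \<le> ((K - 1) * (\<sigma> / 2) * (B - 1)) * a"
      using crit a by (intro mult_right_mono) (auto simp: K_def B_def)
    then have "a \<le> \<sigma> / 2 * a * ((B - 1) * (K - 1))" by (simp add: mult_ac)
    moreover have "(B - 1) * (K - 1) > 0" using B K by simp
    ultimately show ?thesis by (simp only: divide_divide_eq_left pos_divide_le_eq)
  qed
  also have "\<dots> \<le> (1 - 2 powr (-\<sigma>)) * a"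
    using one_minus_two_powr_ge[of \<sigma>] \<sigma> a by (intro mult_right_mono) auto
  finally show "(\<Sum>j=1..N. \<Sum>w\<in>{p^j<..N}. real (p ^ j * w * (w + 1) ^ (k - 1)) powr (-\<sigma>))
      \<le> (1 - 2 powr (-\<sigma>)) * real p powr (-\<sigma>)" by (simp add: a_def P_def)
qed

section \<open>A lower bound for the number of primes\<close>

text \<open>
  The recurrence of the Leibniz harmonic triangle. It expresses each column by differences of the
  previous one, starting from the unit fractions \<open>1 / (n + 1)\<close>, so that a common multiple of
  \<open>1, ..., n + 1\<close> clears the denominators of the whole row \<open>n\<close>.
\<close>

lemma Leibniz_triangle_rec:
  fixes L :: "nat \<Rightarrow> nat \<Rightarrow> real"
  defines "L \<equiv> \<lambda>n m. 1 / (real (Suc n) * real (n choose m))"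
  assumes "m \<le> n"
  shows "L (Suc n) (Suc m) = L n m - L (Suc n) m"
proof -
  define a b c0 c1 c2 where "a = real (Suc n)" and "b = real (Suc m)" and "c0 = real (n choose m)"
    and "c1 = real (Suc n choose m)" and "c2 = real (Suc n choose Suc m)"
  have pos: "a > 0" "b > 0" "c0 > 0" "a - b + 1 > 0" and ab: "a + 1 = real (Suc (Suc n))"
    using assms by (auto simp: a_def b_def c0_def)
  have "c2 * b = a * c0"
    using Suc_times_binomial_eq[of n m] unfolding a_def b_def c0_def c2_def by (metis of_nat_mult)
  then have c2: "c2 = a * c0 / b" using pos by (simp add: field_simps)
  have "(Suc n - m) * (Suc n choose m) = Suc n * (n choose m)"
    using binomial_absorb_comp[of "Suc n" m] by simp
  then have "real (Suc n - m) * c1 = a * c0"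
    unfolding a_def c0_def c1_def by (metis of_nat_mult)
  moreover have "real (Suc n - m) = a - b + 1"
    using assms(2) by (simp add: a_def b_def of_nat_diff)
  ultimately have "(a - b + 1) * c1 = a * c0" by simp
  then have c1: "c1 = a * c0 / (a - b + 1)" using pos by (simp add: field_simps)
  have "1 / ((a + 1) * c2) = 1 / (a * c0) - 1 / ((a + 1) * c1)"
    unfolding c1 c2 using pos by (simp add: divide_simps)
  then show ?thesis unfolding L_def ab[symmetric] a_def c0_def c1_def c2_def by simp
qed

lemma Leibniz_triangle_entry_Ints:
  assumes "m \<le> n" "\<And>i. 1 \<le> i \<Longrightarrow> i \<le> Suc n \<Longrightarrow> i dvd D"
  shows "real D * (1 / (real (Suc n) * real (n choose m))) \<in> \<int>"
  using assms
proof (induction m arbitrary: n)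
  case 0
  have "Suc n dvd D" by (rule 0(2)) auto
  then obtain c where "D = Suc n * c" by (elim dvdE)
  then have "real D = real (Suc n) * real c" by (simp only: of_nat_mult)
  then show ?case by (simp del: of_nat_Suc add: of_nat_Suc[of 0])
next
  case (Suc m)
  then obtain n' where n: "n = Suc n'" "m \<le> n'" by (cases n) auto
  have "real D * (1 / (real (Suc n') * real (n' choose m))) \<in> \<int>"
    "real D * (1 / (real (Suc (Suc n')) * real (Suc n' choose m))) \<in> \<int>"
    by (rule Suc.IH; use Suc.prems n in force)+
  then show ?case
    unfolding n(1) Leibniz_triangle_rec[OF n(2)] right_diff_distrib by (rule Ints_diff)
qed

text \<open>
  By the Leibniz triangle every \<open>(n + 1) * (n choose m)\<close> divides \<open>D\<close>; adding up these
  \<open>n + 1\<close> lower bounds for \<open>D\<close> gives \<open>(n + 1) * 2 ^ n \<le> (n + 1) * D\<close>.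
\<close>

lemma two_power_le_common_multiple:
  assumes D: "D > 0" and dvd: "\<And>i. 1 \<le> i \<Longrightarrow> i \<le> Suc n \<Longrightarrow> i dvd D"
  shows "2 ^ n \<le> D"
proof -
  have le: "Suc n * (n choose m) \<le> D" if "m \<le> n" for m
  proof -
    have pos: "real (Suc n) * real (n choose m) > 0" using that by simp
    have "real D * (1 / (real (Suc n) * real (n choose m))) \<in> \<int>"
      using that dvd by (rule Leibniz_triangle_entry_Ints)
    then obtain z :: int where z: "real D / (real (Suc n) * real (n choose m)) = z"
      by (auto elim: Ints_cases)
    moreover have "real D / (real (Suc n) * real (n choose m)) > 0" using D pos by simp
    ultimately have "z \<ge> 1" by simp
    then have "1 \<le> real D / (real (Suc n) * real (n choose m))" unfolding z by simp
    then have "real (Suc n) * real (n choose m) \<le> real D"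
      using pos by (simp only: pos_le_divide_eq mult_1)
    then show ?thesis by (simp only: of_nat_le_iff flip: of_nat_mult)
  qed
  have "Suc n * 2 ^ n = (\<Sum>m\<le>n. Suc n * (n choose m))"
    by (simp only: choose_row_sum flip: sum_distrib_left)
  also have "\<dots> \<le> (\<Sum>m\<le>n. D)" by (intro sum_mono le) simp
  also have "\<dots> = Suc n * D" by simp
  finally show ?thesis by (rule mult_left_le_imp_le) simp
qed

text \<open>
  The product of the largest prime powers up to \<open>n + 1\<close>, one for each prime, is a common multiple of
  \<open>1, ..., n + 1\<close>, and each of its factors is at most \<open>n + 1\<close>.
\<close>

lemma two_power_le_power_prime_count:
  "2 ^ n \<le> Suc n ^ card {p. prime p \<and> p \<le> Suc n}"
proof -
  let ?N = "Suc n" and ?T = "{p::nat. prime p \<and> p \<le> Suc n}"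
  define e where "e p = (GREATEST e. p ^ e \<le> ?N)" for p :: nat
  have fin: "finite ?T" by simp
  have bound: "a \<le> ?N" if "p ^ a \<le> ?N" "p \<in> ?T" for p a
    using that power_gt_expt[of p a] prime_gt_1_nat[of p] by fastforce
  have e_le: "p ^ e p \<le> ?N" if "p \<in> ?T" for p
    unfolding e_def by (rule GreatestI_nat[of _ 0 ?N]) (use bound that in auto)
  have e_max: "a \<le> e p" if "p \<in> ?T" "p ^ a \<le> ?N" for p a
    unfolding e_def by (rule Greatest_le_nat[of _ _ ?N]) (use bound that in auto)
  define D where "D = (\<Prod>p\<in>?T. p ^ e p)"
  have D0: "D > 0" unfolding D_def by (intro prod_pos) (auto simp: prime_gt_0_nat)
  have "i dvd D" if i: "1 \<le> i" "i \<le> ?N" for i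
  proof -
    have sub: "prime_factors i \<subseteq> ?T"
      using i by (auto simp: in_prime_factors_iff intro: order.trans[OF dvd_imp_le])
    have "i = (\<Prod>p\<in>prime_factors i. p ^ multiplicity p i)"
      using i by (intro prime_factorization_nat) auto
    also have "\<dots> dvd (\<Prod>p\<in>prime_factors i. p ^ e p)"
    proof (intro prod_dvd_prod le_imp_power_dvd e_max)
      fix p assume p: "p \<in> prime_factors i"
      show "p \<in> ?T" using p sub by blast
      have "p ^ multiplicity p i \<le> i" using i by (intro dvd_imp_le multiplicity_dvd) auto
      then show "p ^ multiplicity p i \<le> ?N" using i by simp
    qed
    also have "\<dots> dvd D" unfolding D_def using fin sub by (rule prod_dvd_prod_subset)
    finally show ?thesis .
  qed
  then have "2 ^ n \<le> D" using D0 by (intro two_power_le_common_multiple) auto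
  also have "D \<le> (\<Prod>p\<in>?T. ?N)" unfolding D_def by (intro prod_mono) (use e_le in auto)
  also have "\<dots> = ?N ^ card ?T" by simp
  finally show ?thesis .
qed

lemma kth_prime_prime: "prime (kth_prime k)"
  using enumerate_in_set[OF primes_infinite, of "k - 1"] by (simp add: kth_prime_def)

lemma card_primes_le_kth_prime:
  assumes "k \<ge> 1"
  shows "card {p. prime p \<and> p \<le> kth_prime k} = k"
proof -
  let ?S = "{p::nat. prime p}"
  have "{p. prime p \<and> p \<le> kth_prime k} = enumerate ?S ` {..k - 1}"
  proof (intro set_eqI iffI)
    fix p assume p: "p \<in> {p. prime p \<and> p \<le> kth_prime k}"
    then obtain i where "p = enumerate ?S i" using enumerate_Ex[OF primes_infinite, of p] by auto
    then show "p \<in> enumerate ?S ` {..k - 1}"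
      using p enumerate_mono_le_iff[OF primes_infinite] by (simp add: kth_prime_def)
  next
    fix p assume "p \<in> enumerate ?S ` {..k - 1}"
    then show "p \<in> {p. prime p \<and> p \<le> kth_prime k}"
      using enumerate_in_set[OF primes_infinite] enumerate_mono_le_iff[OF primes_infinite]
      by (auto simp: kth_prime_def)
  qed
  also have "card \<dots> = k"
    using assms primes_infinite by (subst card_image) (auto intro: inj_on_subset[OF inj_enumerate])
  finally show ?thesis .
qed

lemma kth_prime_le:
  assumes "k \<ge> 1" "k \<le> card T" "\<And>p. p \<in> T \<Longrightarrow> prime p \<and> p \<le> N"
  shows "kth_prime k \<le> N"
proof (rule ccontr)
  assume *: "\<not> kth_prime k \<le> N"
  have "T \<subset> {p. prime p \<and> p \<le> kth_prime k}"
  proof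
    show "T \<subseteq> {p. prime p \<and> p \<le> kth_prime k}"
    proof
      fix p assume "p \<in> T"
      then show "p \<in> {p. prime p \<and> p \<le> kth_prime k}" using assms(3)[of p] * by simp
    qed
    show "T \<noteq> {p. prime p \<and> p \<le> kth_prime k}"
      using assms(3)[of "kth_prime k"] * kth_prime_prime[of k] by blast
  qed
  then have "card T < card {p. prime p \<and> p \<le> kth_prime k}" by (intro psubset_card_mono) auto
  then show False using assms by (simp add: card_primes_le_kth_prime)
qed

lemma kth_prime_lower_count:
  assumes "k \<ge> 1"
  shows "(real (kth_prime k) - 1) * ln 2 \<le> real k * ln (real (kth_prime k))"
proof -
  define P where "P = kth_prime k"
  have P: "P > 1" unfolding P_def by (rule prime_gt_1_nat[OF kth_prime_prime])
  have "2 ^ (P - 1) \<le> P ^ k"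
    using two_power_le_power_prime_count[of "P - 1"] P card_primes_le_kth_prime[OF assms]
    by (simp add: P_def)
  then have "(2::real) ^ (P - 1) \<le> real P ^ k"
    by (metis of_nat_le_iff of_nat_numeral of_nat_power)
  then have "ln ((2::real) ^ (P - 1)) \<le> ln (real P ^ k)" using P by (subst ln_le_cancel_iff) auto
  then show ?thesis using P by (simp add: ln_realpow P_def of_nat_diff)
qed

section \<open>The bound for every k\<close>

lemma lcm_primitive_antimono:
  assumes "lcm_primitive k A" "j \<le> k"
  shows "lcm_primitive j A"
  using assms unfolding lcm_primitive_def by (meson order.trans)

text \<open>
  Being lcm \<open>k\<close>-primitive is a stronger property for larger \<open>k\<close>, hence an exponent that is
  admissible for \<open>j\<close> is admissible for all \<open>k \<ge> j\<close>.
\<close>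

lemma lcm_critical_exponent_le:
  assumes "1 \<le> j" "j \<le> k" "prime_sum_bound j \<sigma>" "\<sigma> \<le> \<mu>"
  shows "lcm_critical_exponent k \<le> \<mu>"
proof -
  have "prime_sum_bound k \<sigma>"
    using assms(2,3) lcm_primitive_antimono unfolding prime_sum_bound_def by blast
  then show ?thesis using prime_sum_bound_iff[of k \<sigma>] assms by simp
qed

text \<open>
  The exponent 0.65 is below \<open>1.7 / ln 13\<close>, which serves \<open>k = 4, 5, 6\<close>. The criterion needs
  \<open>2 powr 1.6 \<ge> 3\<close>, that is \<open>3 ^ 5 \<le> 2 ^ 8\<close>.
\<close>

lemma prime_sum_bound_4: "prime_sum_bound 4 (13/20)"
proof (rule prime_sum_bound_criterion)
  have "(3::real) = (3 powr 5) powr (1/5)" by (subst powr_powr) simp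
  also have "\<dots> \<le> (2 powr 8) powr (1/5)" by (intro powr_mono2) auto
  also have "\<dots> = 2 powr (8/5)" by (subst powr_powr) simp
  finally show "(real 4 * (13/20) - 1) * (13/20 / 2) * (2 powr (real 4 * (13/20) - 1) - 1) \<ge> 1"
    by simp
qed auto

text \<open>
  The exponent 0.43 is below \<open>1.7 / 3.9\<close>, which serves all \<open>k \<ge> 7\<close> for which the logarithm of
  the \<open>k\<close>th prime is at most 3.9.
\<close>

lemma prime_sum_bound_7: "prime_sum_bound 7 (43/100)"
proof (rule prime_sum_bound_criterion)
  have "(4::real) = 2 powr 2" by simp
  also have "\<dots> \<le> 2 powr (201/100)" by (intro powr_mono) auto
  finally show "(real 7 * (43/100) - 1) * (43/100 / 2) * (2 powr (real 7 * (43/100) - 1) - 1) \<ge> 1"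
    by simp
qed auto

text \<open>
  Lower bounds for \<open>exp\<close> by rational arithmetic: \<open>m = 8\<close> is accurate enough for all
  numerical values below, and \<open>m = 2\<close> gives a bound with a cubic term in \<open>x\<close>.
\<close>

lemma exp_ge_quadratic_power:
  assumes "0 \<le> (x::real)" "m > 0"
  shows "exp x \<ge> (1 + x / real m + (x / real m)^2 / 2) ^ m"
proof -
  have "(1 + x / real m + (x / real m)^2 / 2) ^ m \<le> exp (x / real m) ^ m"
    using assms by (intro power_mono exp_lower_Taylor_quadratic) auto
  also have "\<dots> = exp x" using assms by (simp flip: exp_of_nat_mult)
  finally show ?thesis .
qed

text \<open>
  Let \<open>L = ln P\<close> for the \<open>k\<close>th prime \<open>P\<close>, and \<open>y = 1.7 * k / L - 1\<close>. The criterion reads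
  \<open>y * (0.85 / L) * (2 powr y - 1) \<ge> 1\<close>, for which \<open>y \<ge> 2\<close> and \<open>y \<ge> 2/5 * L\<close> suffice.
  As \<open>k * L \<ge> (P - 1) * ln 2\<close>, both follow if \<open>P = exp L\<close> exceeds certain cubic polynomials
  in \<open>L\<close>. These are compared coefficientwise in \<open>t = L - 3.9\<close>.
\<close>

lemma prime_sum_bound_large:
  assumes k: "k \<ge> 1" and large: "ln (real (kth_prime k)) \<ge> 39/10"
  shows "prime_sum_bound k (1.7 / ln (real (kth_prime k)))"
proof -
  define P where "P = real (kth_prime k)"
  define L where "L = ln P"
  define t where "t = L - 39/10"
  have t: "t \<ge> 0" and L: "L = 39/10 + t" "L > 0" using large by (simp_all add: t_def L_def P_def)
  have P0: "P > 0" by (simp add: P_def prime_gt_0_nat kth_prime_prime)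
  define y where "y = real k * (1.7 / L) - 1"
  have e39: "exp (39/10::real) \<ge> 44"
  proof -
    have "(44::real) \<le> (1 + (39/10) / real 8 + ((39/10) / real 8)^2 / 2) ^ 8"
      by (simp add: power2_eq_square power_divide)
    also have "\<dots> \<le> exp (39/10)" by (rule exp_ge_quadratic_power) auto
    finally show ?thesis .
  qed
  have "44 * (1 + t + t^2/2 + t^3/8) \<le> 44 * (1 + t / real 2 + (t / real 2)^2 / 2) ^ 2"
    using t by (simp add: power2_eq_square power3_eq_cube field_simps)
  also have "\<dots> \<le> exp (39/10) * exp t"
    using e39 t by (intro mult_mono exp_ge_quadratic_power) auto
  also have "\<dots> = P" using P0 by (simp add: L_def flip: exp_add L(1))
  finally have P: "P \<ge> 44 * (1 + t + t^2/2 + t^3/8)" .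
  have t23: "t^2 \<ge> 0" "t^3 \<ge> 0" using t by simp_all
  have P44: "P \<ge> 44" using P t t23 by argo
  have L2: "3 * L^2 = 4563/100 + 117/5 * t + 3 * t^2"
    by (simp add: L(1) power2_eq_square algebra_simps)
  have L3: "(1 + 2/5 * L) * L^2 = 194688/5000 + 26052/1000 * t + 568/100 * t^2 + 2/5 * t^3"
    by (simp add: L(1) power2_eq_square power3_eq_cube algebra_simps)
  have "1.7 * ((P - 1) * (2/3)) \<le> 1.7 * (real k * L)"
  proof (intro mult_left_mono)
    have "(P - 1) * (2/3) \<le> (P - 1) * ln 2"
      using P44 ln2_ge_two_thirds by (intro mult_left_mono) auto
    also have "\<dots> \<le> real k * L"
      using kth_prime_lower_count[OF k] by (simp add: P_def L_def)
    finally show "(P - 1) * (2/3) \<le> real k * L" .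
  qed simp
  also have "1.7 * (real k * L) = (y + 1) * L^2"
    using L(2) by (simp add: y_def power2_eq_square)
  finally have yP: "1.7 * ((P - 1) * (2/3)) \<le> (y + 1) * L^2" .
  have y2: "y \<ge> 2"
  proof -
    have "3 * L^2 \<le> 1.7 * ((P - 1) * (2/3))"
      unfolding L2 using P t t23 by argo
    then have "3 * L^2 \<le> (y + 1) * L^2" using yP by simp
    then show ?thesis using L(2) by simp
  qed
  have yL: "y \<ge> 2/5 * L"
  proof -
    have "(1 + 2/5 * L) * L^2 \<le> 1.7 * ((P - 1) * (2/3))"
      unfolding L3 using P t t23 by argo
    then have "(1 + 2/5 * L) * L^2 \<le> (y + 1) * L^2" using yP by simp
    then have "1 + 2/5 * L \<le> y + 1" using L(2) by (simp only: mult_le_cancel_right) auto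
    then show ?thesis by simp
  qed
  show ?thesis
    unfolding P_def[symmetric] L_def[symmetric]
  proof (rule prime_sum_bound_criterion[OF k])
    show "0 < 1.7 / L" "1.7 / L \<le> 1" using L t by (auto simp: divide_simps)
    show "real k * (1.7 / L) > 1" using y2 by (simp add: y_def)
    have "2 powr y \<ge> 2 powr 2" using y2 by (intro powr_mono) auto
    then have "y * (1.7 / L / 2) * (2 powr y - 1) \<ge> (2/5 * L) * (1.7 / L / 2) * 3"
      using yL y2 L(2) by (intro mult_mono) auto
    moreover have "(2/5 * L) * (1.7 / L / 2) * 3 = 1.02" using L(2) by (simp add: field_simps)
    ultimately show "1 \<le> (real k * (1.7 / L) - 1) * (1.7 / L / 2) * (2 powr (real k * (1.7 / L) - 1) - 1)"
      by (simp add: y_def)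
  qed
qed

lemma exponent_le_div_ln:
  assumes "c > 0" "1 < P" "real P \<le> exp (1.7 / c)"
  shows "c \<le> 1.7 / ln (real P)"
proof -
  have "ln (real P) \<le> 1.7 / c" using assms
    by (metis ln_exp ln_le_cancel_iff exp_gt_zero of_nat_0_less_iff less_trans zero_less_one)
  moreover have "ln (real P) > 0" using assms by simp
  ultimately show ?thesis using assms(1) by (simp add: field_simps)
qed

lemma lcm_critical_exponent_bound:
  assumes k: "k \<ge> 1"
  shows "lcm_critical_exponent k \<le> 1.7 / ln (real (kth_prime k))"
proof -
  have P1: "kth_prime k > 1" by (rule prime_gt_1_nat[OF kth_prime_prime])
  have div_ln: "c \<le> 1.7 / ln (real (kth_prime k))"
    if "c > 0" "kth_prime k \<le> N" "real N \<le> (1 + (1.7 / c) / real 8 + ((1.7 / c) / real 8)^2 / 2) ^ 8" for c N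
  proof (rule exponent_le_div_ln[OF that(1) P1])
    have "real (kth_prime k) \<le> real N" using that by simp
    also have "\<dots> \<le> (1 + (1.7 / c) / real 8 + ((1.7 / c) / real 8)^2 / 2) ^ 8" by (rule that(3))
    also have "\<dots> \<le> exp (1.7 / c)" using that(1) by (intro exp_ge_quadratic_power) auto
    finally show "real (kth_prime k) \<le> exp (1.7 / c)" .
  qed
  consider "k = 1" | "2 \<le> k" "k \<le> 3" | "4 \<le> k" "k \<le> 6"
    | "7 \<le> k" "ln (real (kth_prime k)) \<le> 39/10" | "ln (real (kth_prime k)) \<ge> 39/10"
    using k by linarith
  then show ?thesis
  proof cases
    case 1
    have "kth_prime k \<le> 2" by (rule kth_prime_le[of _ "{2}"]) (use 1 in auto)
    then have "2 \<le> 1.7 / ln (real (kth_prime k))"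
      by (intro div_ln[of _ 2]) (auto simp: power2_eq_square power_divide)
    then show ?thesis
      using 1 by (intro lcm_critical_exponent_le[OF _ _ prime_sum_bound_two[of 1]]) auto
  next
    case 2
    have "kth_prime k \<le> 5" by (rule kth_prime_le[of _ "{2,3,5}"]) (use 2 in auto)
    then have "1 \<le> 1.7 / ln (real (kth_prime k))"
      by (intro div_ln[of _ 5]) (auto simp: power2_eq_square power_divide)
    then show ?thesis
      using 2 by (intro lcm_critical_exponent_le[OF _ _ prime_sum_bound_2_1]) auto
  next
    case 3
    have "kth_prime k \<le> 13" by (rule kth_prime_le[of _ "{2,3,5,7,11,13}"]) (use 3 in auto)
    then have "13/20 \<le> 1.7 / ln (real (kth_prime k))"
      by (intro div_ln[of _ 13]) (auto simp: power2_eq_square power_divide)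
    then show ?thesis
      using 3 by (intro lcm_critical_exponent_le[OF _ _ prime_sum_bound_4]) auto
  next
    case 4
    have "ln (real (kth_prime k)) > 0" using P1 by simp
    then have "43/100 \<le> 1.7 / ln (real (kth_prime k))" using 4 by (simp add: divide_simps)
    then show ?thesis
      using 4 by (intro lcm_critical_exponent_le[OF _ _ prime_sum_bound_7]) auto
  next
    case 5
    then show ?thesis using k by (intro lcm_critical_exponent_le[OF _ _ prime_sum_bound_large]) auto
  qed
qed

section \<open>The Erdos sum\<close>

text \<open>
  The primes in \<open>(n, 2 * n]\<close> all divide \<open>(2 * n) choose n \<le> 4 ^ n\<close>, so at most
  \<open>n * ln 4 / ln n\<close> of them exist; for \<open>n = 2 ^ j\<close> the logarithms are integers in base 2.
\<close>

lemma card_primes_dyadic: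
  "j * card {p::nat. prime p \<and> 2 ^ j < p \<and> p \<le> 2 ^ Suc j} \<le> 2 ^ Suc j"
proof -
  define n :: nat where "n = 2 ^ j"
  define T where "T = {p::nat. prime p \<and> n < p \<and> p \<le> 2 * n}"
  have fin: "finite T" by (rule finite_subset[of _ "{..2*n}"]) (auto simp: T_def)
  have "n ^ card T = (\<Prod>p\<in>T. n)" by simp
  also have "\<dots> \<le> (\<Prod>p\<in>T. p)" by (intro prod_mono) (auto simp: T_def)
  also have "\<dots> \<le> (2 * n) choose n"
  proof (rule dvd_imp_le)
    show "(\<Prod>p\<in>T. p) dvd (2 * n) choose n"
    proof (rule prod_dvd_if_pairwise_coprime[OF fin])
      fix p assume p: "p \<in> T"
      have "p dvd fact (2 * n)" using p by (simp add: T_def prime_dvd_fact_iff)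
      then have "p dvd fact n * fact n * ((2 * n) choose n)"
        using binomial_fact_lemma[of n "2 * n"] by simp
      moreover have "\<not> p dvd fact n" using p by (simp add: T_def prime_dvd_fact_iff)
      ultimately show "p dvd (2 * n) choose n" using p by (simp add: T_def prime_dvd_mult_iff)
    qed (auto simp: T_def primes_coprime)
  qed simp
  also have "\<dots> \<le> 2 ^ (2 * n)" by (rule binomial_le_pow2)
  finally have "(2::nat) ^ (j * card T) \<le> 2 ^ (2 * n)" by (simp add: n_def power_mult)
  then have "j * card T \<le> 2 * n" by simp
  then show ?thesis by (simp add: n_def T_def)
qed

lemma sum_dyadic_primes_le:
  assumes "j \<ge> 1"
  shows "(\<Sum>p | prime p \<and> 2 ^ j < p \<and> p \<le> 2 ^ Suc j. 1 / (real p * ln (real p))) \<le> 3 / (real j)^2"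
proof -
  let ?T = "{p::nat. prime p \<and> 2 ^ j < p \<and> p \<le> 2 ^ Suc j}"
  have jl: "real j * ln 2 > 0" using assms by simp
  have "(\<Sum>p\<in>?T. 1 / (real p * ln (real p))) \<le> (\<Sum>p\<in>?T. 1 / (2 ^ j * (real j * ln 2)))"
  proof (rule sum_mono)
    fix p assume "p \<in> ?T"
    then have p0: "real p > 0" and "2 ^ j \<le> p" by (auto simp: prime_gt_0_nat)
    from this(2) have p: "2 ^ j \<le> real p" by (metis of_nat_le_iff of_nat_numeral of_nat_power)
    have "real j * ln 2 = ln (2 ^ j)" by (simp add: ln_realpow)
    also have "\<dots> \<le> ln (real p)" using p p0 by (subst ln_le_cancel_iff) auto
    finally have "2 ^ j * (real j * ln 2) \<le> real p * ln (real p)"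
      using p jl by (intro mult_mono) auto
    then show "1 / (real p * ln (real p)) \<le> 1 / (2 ^ j * (real j * ln 2))"
      using jl by (intro frac_le) auto
  qed
  also have "\<dots> = real (card ?T) / (2 ^ j * (real j * ln 2))" by simp
  also have "\<dots> \<le> (2 ^ Suc j / real j) / (2 ^ j * (real j * ln 2))"
  proof (intro divide_right_mono)
    have "real (j * card ?T) \<le> real (2 ^ Suc j)"
      using card_primes_dyadic[of j] by (simp only: of_nat_le_iff)
    then show "real (card ?T) \<le> 2 ^ Suc j / real j"
      using assms by (simp add: pos_le_divide_eq mult.commute)
  qed (use jl in simp)
  also have "\<dots> = (2 / ln 2) / (real j)^2"
    using assms by (simp add: power2_eq_square field_simps)
  also have "\<dots> \<le> 3 / (real j)^2"
    using ln2_ge_two_thirds by (intro divide_right_mono) (auto simp: divide_simps)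
  finally show ?thesis .
qed

text \<open>
  The primes in \<open>(2 ^ j, 2 ^ (j + 1)]\<close> contribute \<open>O(1 / j^2)\<close>. Only the prime 2
  belongs to \<open>j = 0\<close>, and is treated separately.
\<close>

lemma summable_on_primes_inverse_mult_ln:
  "(\<lambda>p. 1 / (real p * ln (real p))) summable_on {p. prime p}"
proof (rule nonneg_bounded_partial_sums_imp_summable_on)
  let ?f = "\<lambda>p::nat. 1 / (real p * ln (real p))"
  show "?f p \<ge> 0" if "p \<in> {p. prime p}" for p
    using that prime_ge_1_nat[of p] by (auto intro!: divide_nonneg_nonneg mult_nonneg_nonneg)
  have "sum ?f F \<le> ?f 2 + 6" if F: "finite F" "F \<subseteq> {p. prime p}" for F
  proof -
    have "\<exists>j. 2 ^ j < p \<and> p \<le> 2 ^ Suc j" if "p \<in> F" for p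
      using that F ex_power_ivl2[of 2 p] prime_ge_2_nat by auto
    then obtain J where J: "\<And>p. p \<in> F \<Longrightarrow> 2 ^ J p < p \<and> p \<le> 2 ^ Suc (J p)" by metis
    define M where "M = Max (insert 1 (J ` F))"
    have M: "M \<ge> 1" "\<And>p. p \<in> F \<Longrightarrow> J p \<le> M" using F(1) by (auto simp: M_def)
    have J1: "J p \<in> {1..M}" if "p \<in> F - {2}" for p
    proof -
      have "p > 2" using that F prime_ge_2_nat[of p] by force
      then have "J p \<noteq> 0" using J[of p] that by (intro notI) simp
      then show ?thesis using M that by simp
    qed
    have nn: "?f p \<ge> 0" if "prime p" for p
      using that prime_ge_1_nat[of p] by (auto intro!: divide_nonneg_nonneg mult_nonneg_nonneg)
    have "sum ?f F \<le> sum ?f (insert 2 (F - {2}))"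
      using F nn by (intro sum_mono2) auto
    also have "\<dots> = ?f 2 + sum ?f (F - {2})" using F by (subst sum.insert) auto
    also have "sum ?f (F - {2}) = (\<Sum>j=1..M. \<Sum>p\<in>{p\<in>F - {2}. J p = j}. ?f p)"
      by (intro sum.group[symmetric] image_subsetI J1) (use F in auto)
    also have "\<dots> \<le> (\<Sum>j=1..M. 3 / (real j)^2)"
    proof (rule sum_mono)
      fix j assume j: "j \<in> {1..M}"
      have "(\<Sum>p\<in>{p\<in>F - {2}. J p = j}. ?f p) \<le> (\<Sum>p | prime p \<and> 2 ^ j < p \<and> p \<le> 2 ^ Suc j. ?f p)"
        using J F nn by (intro sum_mono2) auto
      also have "\<dots> \<le> 3 / (real j)^2" using j by (intro sum_dyadic_primes_le) auto
      finally show "(\<Sum>p\<in>{p\<in>F - {2}. J p = j}. ?f p) \<le> 3 / (real j)^2" .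
    qed
    also have "\<dots> = 3 * (\<Sum>j=1..M. 1 / (real j)^2)" by (simp add: sum_distrib_left)
    also have "(\<Sum>j=1..M. 1 / (real j)^2) \<le> 2"
    proof -
      obtain N where N: "M = Suc N" using M(1) by (cases M) auto
      have "{1..M} = insert 1 {2..Suc N}" using N by auto
      then have "(\<Sum>j=1..M. 1 / (real j)^2) = 1 + (\<Sum>j\<in>{2..Suc N}. 1 / (real j)^2)" by simp
      also have "\<dots> \<le> 2" using sum_inverse_squares_le[of N] by (smt (verit) divide_nonneg_nonneg of_nat_0_le_iff)
      finally show ?thesis .
    qed
    finally show ?thesis by simp
  qed
  then show "\<forall>\<^sub>F F in finite_subsets_at_top {p. prime p}. sum ?f F \<le> ?f 2 + 6"
    by (intro eventually_finite_subsets_at_top_weakI) auto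
qed

text \<open>
  Partial summation: the bound for all initial segments \<open>[1, x]\<close> survives multiplication by a
  nonnegative decreasing weight. The weight need only decrease from 2 on, as \<open>1 / ln n\<close> does,
  because neither \<open>A\<close> nor the primes contain 1.
\<close>

lemma prime_sum_bound_weighted:
  assumes bound: "prime_sum_bound k \<sigma>" and A: "lcm_primitive k A" and x: "x \<ge> 0"
    and w: "\<And>n. n \<ge> 2 \<Longrightarrow> w (Suc n) \<le> w n" "\<And>n. n \<ge> 2 \<Longrightarrow> w n \<ge> 0"
  shows "(\<Sum>n | n \<in> A \<and> real n \<le> x. w n * real n powr (-\<sigma>))
      \<le> (\<Sum>p | prime p \<and> real p \<le> x. w p * real p powr (-\<sigma>))"
proof -
  have A1: "n > 1" if "n \<in> A" for n using A that by (auto simp: lcm_primitive_def)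
  then have A0: "0 \<notin> A" "Suc 0 \<notin> A" by force+
  let ?P = "{p::nat. prime p}"
  have P0: "0 \<notin> ?P" by simp
  define g where "g B i = (if Suc i \<in> B then real (Suc i) powr (-\<sigma>) else 0)" for B i
  define d where "d i = g ?P i - g A i" for i
  have d0: "d 0 = 0" using A0 by (simp add: d_def g_def)
  \<comment> \<open>Replaces the weight at 1 by that at 2, which makes the weight decreasing on all indices.\<close>
  define v where "v i = w (max 2 (Suc i))" for i
  have vd: "v i * d i = (if Suc i \<in> ?P then w (Suc i) * real (Suc i) powr (-\<sigma>) else 0)
      - (if Suc i \<in> A then w (Suc i) * real (Suc i) powr (-\<sigma>) else 0)" for i
  proof (cases "i = 0")
    case True
    then show ?thesis using d0 A0 by simp
  next
    case False
    then have "max 2 (Suc i) = Suc i" by simp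
    then show ?thesis by (simp add: v_def d_def g_def algebra_simps)
  qed
  have D: "(\<Sum>i<m. d i) \<ge> 0" for m
  proof (cases "m \<le> 1")
    case True
    then have "m = 0 \<or> m = 1" by auto
    then show ?thesis using d0 by auto
  next
    case False
    then have "(\<Sum>n | n \<in> A \<and> real n \<le> real m. real n powr (-\<sigma>))
        \<le> (\<Sum>n | n \<in> ?P \<and> real n \<le> real m. real n powr (-\<sigma>))"
      using bound[unfolded prime_sum_bound_def, rule_format, of A "real m"] A by simp
    then show ?thesis
      unfolding sum_le_as_lessThan[OF A0(1) of_nat_0_le_iff] sum_le_as_lessThan[OF P0 of_nat_0_le_iff]
      by (simp add: d_def g_def sum_subtractf)
  qed
  have "(\<Sum>i<nat \<lfloor>x\<rfloor>. v i * d i) \<ge> 0"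
  proof (rule weighted_sum_nonneg[OF D])
    show "v (Suc i) \<le> v i" for i using w(1)[of "Suc i"] by (cases "i = 0") (auto simp: v_def numeral_2_eq_2)
    show "v i \<ge> 0" for i by (simp add: v_def w(2))
  qed
  then have "(\<Sum>n | n \<in> A \<and> real n \<le> x. w n * real n powr (-\<sigma>))
        \<le> (\<Sum>n | n \<in> ?P \<and> real n \<le> x. w n * real n powr (-\<sigma>))"
    using x unfolding vd sum_subtractf
    by (simp only: sum_le_as_lessThan[OF A0(1)] sum_le_as_lessThan[OF P0])
  then show ?thesis by simp
qed

lemma sum_inverse_mult_ln_le_sum_primes:
  assumes A: "lcm_primitive 2 A"
  shows "(\<lambda>n. 1 / (real n * ln (real n))) summable_on A"
    and "(\<Sum>\<^sub>\<infinity>n\<in>A. 1 / (real n * ln (real n))) \<le> (\<Sum>\<^sub>\<infinity>p\<in>{p. prime p}. 1 / (real p * ln (real p)))"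
proof -
  let ?f = "\<lambda>n::nat. 1 / (real n * ln (real n))"
  let ?S = "\<Sum>\<^sub>\<infinity>p\<in>{p. prime p}. ?f p"
  have nn: "?f n \<ge> 0" if "n > 1" for n
    using that by (auto intro!: divide_nonneg_nonneg mult_nonneg_nonneg)
  have A1: "n > 1" if "n \<in> A" for n using A that by (auto simp: lcm_primitive_def)
  have fin: "sum ?f F \<le> ?S" if F: "finite F" "F \<subseteq> A" for F
  proof -
    define x where "x = real (Max (insert 0 F))"
    have Fx: "real n \<le> x" if "n \<in> F" for n using that F(1) by (simp add: x_def)
    have "{n. n \<in> A \<and> real n \<le> x} \<subseteq> {..Max (insert 0 F)}" by (auto simp: x_def)
    then have finA: "finite {n. n \<in> A \<and> real n \<le> x}" by (rule finite_subset) simp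
    have "{p. prime p \<and> real p \<le> x} \<subseteq> {..Max (insert 0 F)}" by (auto simp: x_def)
    then have finP: "finite {p. prime p \<and> real p \<le> x}" by (rule finite_subset) simp
    have "sum ?f F \<le> (\<Sum>n | n \<in> A \<and> real n \<le> x. ?f n)"
      using F Fx A1 by (intro sum_mono2 finA nn) auto
    also have "\<dots> = (\<Sum>n | n \<in> A \<and> real n \<le> x. 1 / ln (real n) * real n powr (-1))"
      by (simp add: powr_minus_divide mult.commute)
    also have "\<dots> \<le> (\<Sum>p | prime p \<and> real p \<le> x. 1 / ln (real p) * real p powr (-1))"
      by (rule prime_sum_bound_weighted[OF prime_sum_bound_2_1 A])
        (auto simp: x_def intro!: frac_le)
    also have "\<dots> = (\<Sum>p | prime p \<and> real p \<le> x. ?f p)"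
      by (simp add: powr_minus_divide mult.commute)
    also have "\<dots> \<le> ?S"
      using finP by (intro finite_sum_le_infsum summable_on_primes_inverse_mult_ln nn)
        (auto dest: prime_gt_1_nat)
    finally show ?thesis .
  qed
  show sA: "?f summable_on A"
  proof (rule nonneg_bounded_partial_sums_imp_summable_on)
    show "?f n \<ge> 0" if "n \<in> A" for n using that by (intro nn A1)
    show "\<forall>\<^sub>F F in finite_subsets_at_top A. sum ?f F \<le> ?S"
      by (intro eventually_finite_subsets_at_top_weakI fin)
  qed
  show "(\<Sum>\<^sub>\<infinity>n\<in>A. ?f n) \<le> ?S" by (rule infsum_le_finite_sums[OF sA fin])
qed

theorem theorem3:
  shows "(\<forall>k\<ge>1. lcm_critical_exponent k \<le> 1.7 / ln (real (kth_prime k)))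
    \<and> lcm_critical_exponent 2 \<le> 1
    \<and> (\<forall>A. lcm_primitive 2 A \<longrightarrow>
          (\<lambda>n. 1 / (real n * ln (real n))) summable_on A
          \<and> (\<Sum>\<^sub>\<infinity>n\<in>A. 1 / (real n * ln (real n)))
               \<le> (\<Sum>\<^sub>\<infinity>p\<in>{p. prime p}. 1 / (real p * ln (real p))))"
  using lcm_critical_exponent_bound prime_sum_bound_2_1 prime_sum_bound_iff[of 2 1]
    sum_inverse_mult_ln_le_sum_primes
  by auto

end
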